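(* Let $X,Z$ be complex Hilbert spaces, let $E\in L(X,Z)$, let $A\colon\mathrm{dom}(A)\subseteq X\to Z$ be closed and densely defined, and assume $\rho(E,A)\neq\emptyset$. Let $\begin{pmatrix}x_0\\ f\end{pmatrix}\in\mathcal C_{(E,A_{-1})}$ and let $x\colon[0,\infty)\to X$ be such that $\begin{pmatrix}x\\ f\end{pmatrix}\colon[0,\infty)\to X\times Z_{-1}$ is a classical solution of the augmented system $$\frac{\mathrm d}{\mathrm dt}\begin{bmatrix}E&0\end{bmatrix}\begin{pmatrix}x(t)\\ f(t)\end{pmatrix}=\begin{bmatrix}A_{-1}&I_{Z_{-1}}\end{bmatrix}\begin{pmatrix}x(t)\\ f(t)\end{pmatrix},\quad t\ge0,\qquad \begin{pmatrix}Ex(0)\\ f(0)\end{pmatrix}=\begin{pmatrix}Ex_0\\ f(0)\end{pmatrix}.$$ Then $$\begin{pmatrix}x(t)\\ f(t)\end{pmatrix}\in\bigcap_{i\in\mathbb{N}_0}\overline{\mathcal V_i},\qquad t\ge0,$$ where $(\mathcal V_i)_{i\in\mathbb{N}_0}$ is the augmented Wong sequence of $(E,A,I_{Z_{-1}})$ and the closures are taken in $X\times Z_{-1}$.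
   Context: $\rho(E,A)$ is the set of all $\lambda\in\mathbb{C}$ such that $\lambda E-A\colon\mathrm{dom}(A)\to Z$ is bijective with $(\lambda E-A)^{-1}\in L(Z,X)$. $Z_{-1}$ is the completion of $Z$ with respect to the norm $\|z\|_{Z_{-1}}=\|(\mu E-A)^{-1}z\|_X$, $\mu\in\rho(E,A)$ (different $\mu$ give equivalent norms), and $A_{-1}\in L(X,Z_{-1})$ is the unique bounded extension of $A$ to all of $X$. Classical solution: given $x_0\in X$ and $f\colon[0,\infty)\to Z_{-1}$, a function $x\colon[0,\infty)\to X$ is a classical solution of $$\frac{\mathrm d}{\mathrm dt}Ex(t)=A_{-1}x(t)+f(t),\ t\ge0,\qquad Ex(0)=Ex_0 \qquad ( * )$$ if $x\in C([0,\infty);X)$, $Ex\in C([0,\infty);Z)\cap C^1([0,\infty);Z_{-1})$ and $x$ satisfies $( * )$ for all $t\ge 0$. A classical solution $\begin{pmatrix}x\\ f\end{pmatrix}$ of the augmented system is understood in the same sense for the operator pair $(\begin{bmatrix}E&0\end{bmatrix},\begin{bmatrix}A_{-1}&I_{Z_{-1}}\end{bmatrix})$, i.e. $x$ and $f$ are continuous with values in $X$ and $Z_{-1}$, $Ex\in C([0,\infty);Z)\cap C^1([0,\infty);Z_{-1})$ and the system holds for all $t\geq0$. $\mathcal C_{(E,A_{-1})}$ is the set of all $\begin{pmatrix}x_0\\ f\end{pmatrix}\in X\times L^1([0,\infty);Z_{-1})$ for which there exists a classical solution of $( * )$. Augmented Wong sequence of $(E,A,I_{Z_{-1}})$: $\mathcal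 V_0=X\times Z_{-1}$ and, for $i\in\mathbb{N}_0$, $$\mathcal V_{i+1}=\Big\{\begin{pmatrix}x\\ z\end{pmatrix}\in X\times Z_{-1}\;:\;A_{-1}x+z\in\begin{bmatrix}E&0\end{bmatrix}(\mathcal V_i)\Big\},\qquad \begin{bmatrix}E&0\end{bmatrix}(\mathcal V_i)=\{Ev:(v,w)\in\mathcal V_i\}.$$ *)

theory Defs
  imports "HOL-Analysis.Analysis"
begin

class complex_normed_vector = real_normed_vector +
  fixes scaleC :: "complex \<Rightarrow> 'a \<Rightarrow> 'a" (infixr "*c" 75)
  assumes scaleC_add_right: "a *c (x + y) = a *c x + a *c y"
    and scaleC_add_left: "(a + b) *c x = a *c x + b *c x"
    and scaleC_scaleC: "a *c (b *c x) = (a * b) *c x"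
    and scaleC_of_real: "complex_of_real r *c x = r *\<^sub>R x"
    and norm_scaleC: "norm (a *c x) = cmod a * norm x"

class complex_banach = complex_normed_vector + complete_space

class complex_hilbert = complex_banach +
  fixes cinner :: "'a \<Rightarrow> 'a \<Rightarrow> complex"
  assumes cinner_commute: "cinner x y = cnj (cinner y x)"
    and cinner_add_left: "cinner (x + y) z = cinner x z + cinner y z"
    and cinner_scaleC_left: "cinner (a *c x) y = a * cinner x y"
    and cinner_self: "cinner x x = complex_of_real ((norm x)\<^sup>2)"

instance complex_banach \<subseteq> banach ..

definition csubspace :: "'a::complex_normed_vector set \<Rightarrow> bool" where
  "csubspace D \<longleftrightarrow> 0 \<in> D \<and> (\<forall>x\<in>D. \<forall>y\<in>D. x + y \<in> D) \<and> (\<forall>c. \<forall>x\<in>D. c *c x \<in> D)"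

definition clinear_on ::
    "'a::complex_normed_vector set \<Rightarrow> ('a \<Rightarrow> 'b::complex_normed_vector) \<Rightarrow> bool" where
  "clinear_on D T \<longleftrightarrow> csubspace D \<and> (\<forall>x\<in>D. \<forall>y\<in>D. T (x + y) = T x + T y) \<and>
     (\<forall>c. \<forall>x\<in>D. T (c *c x) = c *c T x)"

definition bounded_clinear :: "('a::complex_normed_vector \<Rightarrow> 'b::complex_normed_vector) \<Rightarrow> bool" where
  "bounded_clinear T \<longleftrightarrow> clinear_on UNIV T \<and> (\<exists>K. \<forall>x. norm (T x) \<le> K * norm x)"

text \<open>An unbounded operator is a total function together with its domain \<open>D\<close>; its values
  outside \<open>D\<close> are irrelevant.\<close>

definition closed_operator ::
    "'a::complex_normed_vector set \<Rightarrow> ('a \<Rightarrow> 'b::complex_normed_vector) \<Rightarrow> bool" where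
  "closed_operator D A \<longleftrightarrow> clinear_on D A \<and> closed ((\<lambda>x. (x, A x)) ` D)"

definition densely_defined :: "'a::topological_space set \<Rightarrow> bool" where
  "densely_defined D \<longleftrightarrow> closure D = UNIV"

definition pencil_inverse :: "('a::complex_normed_vector \<Rightarrow> 'b::complex_normed_vector) \<Rightarrow>
    'a set \<Rightarrow> ('a \<Rightarrow> 'b) \<Rightarrow> complex \<Rightarrow> 'b \<Rightarrow> 'a" where
  "pencil_inverse E D A \<mu> = inv_into D (\<lambda>x. \<mu> *c E x - A x)"

definition resolvent_set :: "('a::complex_normed_vector \<Rightarrow> 'b::complex_normed_vector) \<Rightarrow>
    'a set \<Rightarrow> ('a \<Rightarrow> 'b) \<Rightarrow> complex set" where
  "resolvent_set E D A =
     {\<mu>. bij_betw (\<lambda>x. \<mu> *c E x - A x) D UNIV \<and> bounded_clinear (pencil_inverse E D A \<mu>)}"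

text \<open>A completion of a space with respect to a norm \<open>N\<close> (in general different from the norm
  of its type) is a Banach space with a linear map \<open>\<iota>\<close> into it that has dense range and is
  isometric for \<open>N\<close>. It is unique up to isometric isomorphism compatible with the embeddings.\<close>

definition completion_embedding ::
    "('a::complex_normed_vector \<Rightarrow> real) \<Rightarrow> ('a \<Rightarrow> 'b::complex_banach) \<Rightarrow> bool" where
  "completion_embedding N \<iota> \<longleftrightarrow>
     clinear_on UNIV \<iota> \<and> (\<forall>z. norm (\<iota> z) = N z) \<and> closure (range \<iota>) = UNIV"

definition extrapolation_norm :: "('a::complex_normed_vector \<Rightarrow> 'b::complex_normed_vector) \<Rightarrow>
    'a set \<Rightarrow> ('a \<Rightarrow> 'b) \<Rightarrow> complex \<Rightarrow> 'b \<Rightarrow> real" where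
  "extrapolation_norm E D A \<mu> z = norm (pencil_inverse E D A \<mu> z)"

definition bounded_extension :: "('b \<Rightarrow> 'c::complex_banach) \<Rightarrow>
    'a::complex_normed_vector set \<Rightarrow> ('a \<Rightarrow> 'b) \<Rightarrow> 'a \<Rightarrow> 'c" where
  "bounded_extension \<iota> D A = (THE B. bounded_clinear B \<and> (\<forall>x\<in>D. B x = \<iota> (A x)))"

lemma bounded_clinear_imp_bounded_linear:
  assumes "bounded_clinear T"
  shows "bounded_linear T"
proof -
  obtain K where "\<forall>x. norm (T x) \<le> K * norm x"
    using assms by (auto simp: bounded_clinear_def)
  moreover have "T (x + y) = T x + T y" "T (r *\<^sub>R x) = r *\<^sub>R T x" for x y r
    using assms by (auto simp: bounded_clinear_def clinear_on_def simp flip: scaleC_of_real)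
  ultimately show ?thesis
    by (intro bounded_linear_intro[where K = K]) (auto simp: mult.commute)
qed

lemma bounded_linear_scaleC: "bounded_linear ((*c) (c :: complex) :: 'a::complex_normed_vector \<Rightarrow> 'a)"
proof (rule bounded_linear_intro[where K = "cmod c"])
  fix r :: real and x :: 'a
  show "c *c r *\<^sub>R x = r *\<^sub>R c *c x"
    by (simp add: scaleC_scaleC mult.commute flip: scaleC_of_real)
qed (simp_all add: scaleC_add_right norm_scaleC)

lemma clinear_on_diff:
  assumes "clinear_on D T" "x \<in> D" "y \<in> D"
  shows "x - y \<in> D" "T (x - y) = T x - T y"
proof -
  have m: "- v = (-1) *c v" for v :: "'c::complex_normed_vector"
    using scaleC_of_real[of "-1" v] by simp
  have "-y \<in> D" "T (-y) = - T y"
    using assms by (auto simp: clinear_on_def csubspace_def m)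
  thus "x - y \<in> D" "T (x - y) = T x - T y"
    using assms unfolding diff_conv_add_uminus by (auto simp: clinear_on_def csubspace_def)
qed

lemma ex1_bounded_clinear_extension:
  fixes g :: "'a::complex_normed_vector \<Rightarrow> 'b::complex_banach"
  assumes g: "clinear_on D g" and dense: "closure D = UNIV"
    and K: "\<And>x. x \<in> D \<Longrightarrow> norm (g x) \<le> K * norm x"
  shows "\<exists>!B. bounded_clinear B \<and> (\<forall>x\<in>D. B x = g x)"
proof -
  have "(max K 0)-lipschitz_on D g"
  proof (rule lipschitz_onI)
    fix x y assume "x \<in> D" "y \<in> D"
    then have "dist (g x) (g y) \<le> K * norm (x - y)"
      using K[of "x - y"] clinear_on_diff[OF g, of x y] by (simp add: dist_norm)
    also have "\<dots> \<le> max K 0 * norm (x - y)"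
      by (intro mult_right_mono) auto
    finally show "dist (g x) (g y) \<le> max K 0 * dist x y"
      by (simp add: dist_norm)
  qed auto
  then have "uniformly_continuous_on D g"
    by (rule lipschitz_on_uniformly_continuous)
  then obtain B where B: "uniformly_continuous_on (closure D) B" "\<And>x. x \<in> D \<Longrightarrow> g x = B x"
    by (rule uniformly_continuous_on_extension_on_closure) metis
  have cont: "continuous_on UNIV B"
    using B(1) dense by (simp add: uniformly_continuous_imp_continuous)
  note c [continuous_intros] = continuous_on_compose2[OF cont]
  note s [continuous_intros] = bounded_linear.continuous_on[OF bounded_linear_scaleC]
  have ext: "T x = S x" if "continuous_on UNIV T" "continuous_on UNIV S" "\<And>x. x \<in> D \<Longrightarrow> T x = S x"
    for T S :: "'a \<Rightarrow> 'b" and x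
  proof -
    have "closure D \<subseteq> {x. T x = S x}"
      using that by (intro closure_minimal closed_Collect_eq) auto
    thus ?thesis using dense by auto
  qed
  have "B (c *c x) = c *c B x" for c x
  proof (rule ext[of "\<lambda>x. B (c *c x)"])
    show "B (c *c x) = c *c B x" if "x \<in> D" for x
      using g B(2)[symmetric] that by (auto simp: clinear_on_def csubspace_def)
  qed (intro continuous_intros cont; simp)+
  moreover have "B (x + y) = B x + B y" for x y
  proof (rule ext[of "\<lambda>x. B (x + y)"])
    show "B (x + y) = B x + B y" if "x \<in> D" for x
    proof (rule ext[of "\<lambda>y. B (x + y)"])
      show "B (x + y) = B x + B y" if "y \<in> D" for y
        using g B(2)[symmetric] \<open>x \<in> D\<close> that by (auto simp: clinear_on_def csubspace_def)
    qed (intro continuous_intros cont; simp)+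
  qed (intro continuous_intros cont; simp)+
  moreover have "norm (B x) \<le> K * norm x" for x
  proof -
    have "closure D \<subseteq> {x. norm (B x) \<le> K * norm x}"
      using K B(2) by (intro closure_minimal closed_Collect_le continuous_intros cont) auto
    thus ?thesis using dense by auto
  qed
  ultimately have "bounded_clinear B"
    by (auto simp: bounded_clinear_def clinear_on_def csubspace_def)
  moreover have "T = B" if T: "bounded_clinear T" "\<forall>x\<in>D. T x = g x" for T
  proof
    have "continuous_on UNIV T"
      using T(1) by (intro linear_continuous_on bounded_clinear_imp_bounded_linear)
    moreover have "T x = B x" if "x \<in> D" for x
      using T(2) B(2) that by simp
    ultimately show "T x = B x" for x
      using ext[of T B x] cont by blast
  qed
  ultimately show ?thesis
    using B(2) by (intro ex1I[of _ B]) auto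
qed

lemma bounded_extension:
  fixes \<iota> :: "'z::complex_normed_vector \<Rightarrow> 'w::complex_banach"
  assumes E: "bounded_clinear E" and A: "clinear_on D A" and dense: "densely_defined D"
    and \<mu>: "\<mu> \<in> resolvent_set E D A" and \<iota>: "completion_embedding (extrapolation_norm E D A \<mu>) \<iota>"
  shows "bounded_clinear (bounded_extension \<iota> D A)"
    and "x \<in> D \<Longrightarrow> bounded_extension \<iota> D A x = \<iota> (A x)"
proof -
  let ?P = "\<lambda>x. \<mu> *c E x - A x" and ?R = "pencil_inverse E D A \<mu>"
  have n: "norm (\<iota> z) = norm (?R z)" for z
    using \<iota> by (simp add: completion_embedding_def extrapolation_norm_def)
  have \<iota>lin: "clinear_on UNIV \<iota>"
    using \<iota> by (simp add: completion_embedding_def)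
  have bij: "bij_betw ?P D UNIV" and "bounded_clinear ?R"
    using \<mu> by (auto simp: resolvent_set_def)
  then interpret R: bounded_linear ?R
    by (simp add: bounded_clinear_imp_bounded_linear)
  interpret E: bounded_linear E
    using E by (rule bounded_clinear_imp_bounded_linear)
  obtain K where K: "K \<ge> 0" "\<And>x. norm (?R x) \<le> norm x * K"
    using R.nonneg_bounded by blast
  obtain L where L: "L \<ge> 0" "\<And>x. norm (E x) \<le> norm x * L"
    using E.nonneg_bounded by blast
  have "\<exists>!B. bounded_clinear B \<and> (\<forall>x\<in>D. B x = (\<lambda>x. \<iota> (A x)) x)"
  proof (rule ex1_bounded_clinear_extension)
    show "clinear_on D (\<lambda>x. \<iota> (A x))"
      using A \<iota>lin by (auto simp: clinear_on_def)
    show "closure D = UNIV"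
      using dense by (simp add: densely_defined_def)
    fix x assume x: "x \<in> D"
    have "?R (?P x) = x"
      using inv_into_f_f[OF bij_betw_imp_inj_on[OF bij] x] by (simp add: pencil_inverse_def)
    then have "norm (\<iota> (?P x)) = norm x"
      by (simp add: n)
    moreover have "\<iota> (A x) = \<iota> (\<mu> *c E x) - \<iota> (?P x)"
      using clinear_on_diff(2)[OF \<iota>lin, of "\<mu> *c E x" "?P x"] by simp
    ultimately have "norm (\<iota> (A x)) \<le> norm (?R (\<mu> *c E x)) + norm x"
      by (metis n norm_triangle_ineq4)
    also have "norm (?R (\<mu> *c E x)) \<le> cmod \<mu> * (norm x * L) * K"
      using K(2)[of "\<mu> *c E x"] mult_right_mono[OF mult_left_mono[OF L(2)[of x], of "cmod \<mu>"] K(1)]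
      by (simp add: norm_scaleC)
    finally show "norm (\<iota> (A x)) \<le> (cmod \<mu> * L * K + 1) * norm x"
      by (simp add: algebra_simps)
  qed
  from theI'[OF this]
  have "bounded_clinear (bounded_extension \<iota> D A) \<and>
      (\<forall>x\<in>D. bounded_extension \<iota> D A x = \<iota> (A x))"
    unfolding bounded_extension_def .
  then show "bounded_clinear (bounded_extension \<iota> D A)"
    and "x \<in> D \<Longrightarrow> bounded_extension \<iota> D A x = \<iota> (A x)"
    by blast+
qed

text \<open>Functions on the half-line are total functions on the reals of which only the restriction
  to \<open>{0..}\<close> matters; derivatives at 0 are one-sided.\<close>

definition C1_halfline :: "(real \<Rightarrow> 'w::real_normed_vector) \<Rightarrow> bool" where
  "C1_halfline h \<longleftrightarrow> (\<exists>h'. continuous_on {0..} h' \<and>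
     (\<forall>t\<ge>0. (h has_vector_derivative h' t) (at t within {0..})))"

text \<open>\<open>classical_solution \<iota> E B f s0 s\<close>: the function \<open>s\<close> solves \<open>d/dt E s = B s + f\<close>,
  \<open>E (s 0) = E s0\<close>, where \<open>E\<close> maps the state space into \<open>Z\<close>, while \<open>B\<close> and \<open>f\<close> take values in the
  larger space into which \<open>\<iota>\<close> embeds \<open>Z\<close>.\<close>

definition classical_solution :: "('z::real_normed_vector \<Rightarrow> 'w::real_normed_vector) \<Rightarrow>
    ('s::real_normed_vector \<Rightarrow> 'z) \<Rightarrow> ('s \<Rightarrow> 'w) \<Rightarrow> (real \<Rightarrow> 'w) \<Rightarrow> 's \<Rightarrow> (real \<Rightarrow> 's) \<Rightarrow> bool" where
  "classical_solution \<iota> E B f s0 s \<longleftrightarrow>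
     continuous_on {0..} s \<and>
     continuous_on {0..} (\<lambda>t. E (s t)) \<and>
     C1_halfline (\<lambda>t. \<iota> (E (s t))) \<and>
     (\<forall>t\<ge>0. ((\<lambda>t. \<iota> (E (s t))) has_vector_derivative B (s t) + f t) (at t within {0..})) \<and>
     E (s 0) = E s0"

text \<open>Bochner integrability on the half-line, defined via strong measurability because
  \<^const>\<open>integrable\<close> is restricted to separable (second countable) spaces. Elements are functions, not classes modulo
  null sets, since the equation is required at every \<open>t\<close>.\<close>

definition L1_halfline :: "(real \<Rightarrow> 'w::real_normed_vector) \<Rightarrow> bool" where
  "L1_halfline f \<longleftrightarrow>
     (\<exists>s. (\<forall>n::nat. simple_function (lebesgue_on {0..}) (s n)) \<and>
          (AE t in lebesgue_on {0..}. (\<lambda>n. s n t) \<longlonglongrightarrow> f t)) \<and>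
     (\<integral>\<^sup>+ t. ennreal (norm (f t)) \<partial>lebesgue_on {0..}) < \<infinity>"

definition consistent_data :: "('z::real_normed_vector \<Rightarrow> 'w::real_normed_vector) \<Rightarrow>
    ('x::real_normed_vector \<Rightarrow> 'z) \<Rightarrow> ('x \<Rightarrow> 'w) \<Rightarrow> ('x \<times> (real \<Rightarrow> 'w)) set" where
  "consistent_data \<iota> E B = {(x0, f). L1_halfline f \<and> (\<exists>x. classical_solution \<iota> E B f x0 x)}"

primrec augmented_wong :: "('z \<Rightarrow> 'w::plus) \<Rightarrow> ('x \<Rightarrow> 'z) \<Rightarrow> ('x \<Rightarrow> 'w) \<Rightarrow> nat \<Rightarrow> ('x \<times> 'w) set" where
  "augmented_wong \<iota> E B 0 = UNIV"
| "augmented_wong \<iota> E B (Suc i) =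
     {(x, z). B x + z \<in> \<iota> ` {E v |v w. (v, w) \<in> augmented_wong \<iota> E B i}}"

end

theory Submission
  imports Defs
begin

text \<open>Write \<open>u = (x, f)\<close>, \<open>L = \<iota> [E 0]\<close> and \<open>G = [A\<^sub>-\<^sub>1 I]\<close>, so that \<open>(L u)' = G u\<close> and \<open>V\<close> is the Wong
  sequence of \<open>(L, G)\<close>. The average of \<open>u\<close> over \<open>[t, t + h]\<close> is again a solution, and \<open>G\<close> maps it to
  \<open>L ((u (t + h) - u t) / h)\<close>. As each \<open>V\<^sub>i\<close> is a subspace, averaging a solution with values in \<open>V\<^sub>i\<close>
  gives one with values in \<open>V\<^bsub>i+1\<^esub>\<close>. So \<open>i\<close> successive averages of an arbitrary solution lie in \<open>V\<^sub>i\<close>,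
  and they approximate it at each \<open>t\<close> as the window lengths tend to 0.\<close>

lemma has_vector_derivative_integral_halfline:
  fixes u :: "real \<Rightarrow> 'a::banach"
  assumes u: "continuous_on {0..} u" and t: "t \<ge> 0"
  shows "((\<lambda>t. integral {0..t} u) has_vector_derivative u t) (at t within {0..})"
proof -
  have "((\<lambda>t. integral {0..t} u) has_vector_derivative u t) (at t within {0..t + 1})"
    using t by (intro integral_has_vector_derivative continuous_on_subset[OF u]) auto
  \<comment> \<open>The endpoint \<open>t + 1\<close> leaves room to the right of \<open>t\<close>,
    so both sets agree near \<open>t\<close>, even at \<open>t = 0\<close>.\<close>
  moreover have "at t within {0..} = at t within {0..t + 1}"
    using t by (intro at_within_nhd[of t "{..<t + 1}"]) auto
  ultimately show ?thesis by simp
qed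

definition solution :: "('a::real_normed_vector \<Rightarrow> 'b::real_normed_vector) \<Rightarrow> ('a \<Rightarrow> 'b) \<Rightarrow>
    (real \<Rightarrow> 'a) \<Rightarrow> bool" where
  "solution L G u \<longleftrightarrow> continuous_on {0..} u \<and>
     (\<forall>t\<ge>0. ((\<lambda>t. L (u t)) has_vector_derivative G (u t)) (at t within {0..}))"

text \<open>The difference of primitives based at 0 lets the derivative of the primitive and the
  integrated equation be applied to each term separately.\<close>

definition average :: "real \<Rightarrow> (real \<Rightarrow> 'a::real_normed_vector) \<Rightarrow> real \<Rightarrow> 'a" where
  "average h u t = (integral {0..t + h} u - integral {0..t} u) /\<^sub>R h"

lemma has_vector_derivative_average:
  fixes u :: "real \<Rightarrow> 'a::banach"
  assumes u: "continuous_on {0..} u" and h: "h > 0" and t: "t \<ge> 0"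
  shows "(average h u has_vector_derivative (u (t + h) - u t) /\<^sub>R h) (at t within {0..})"
proof -
  let ?U = "\<lambda>t. integral {0..t} u"
  \<comment> \<open>The chain rule along the shift asks for a derivative within the image
    \<open>{h..}\<close> of the half-line, a subset of \<open>{0..}\<close>.\<close>
  have "(?U has_vector_derivative u (t + h)) (at (t + h) within (\<lambda>t. t + h) ` {0..})"
    using h t by (intro has_vector_derivative_within_subset[OF
      has_vector_derivative_integral_halfline[OF u]]) auto
  then have "((?U \<circ> (\<lambda>t. t + h)) has_vector_derivative 1 *\<^sub>R u (t + h)) (at t within {0..})"
    by (intro vector_diff_chain_within) (auto intro!: derivative_eq_intros)
  then have "((\<lambda>t. ?U (t + h)) has_vector_derivative u (t + h)) (at t within {0..})"
    by (simp add: o_def)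
  from has_vector_derivative_diff[OF this has_vector_derivative_integral_halfline[OF u t]]
  show ?thesis
    unfolding average_def
    by (rule bounded_linear.has_vector_derivative[OF bounded_linear_scaleR_right])
qed

text \<open>The average is the difference quotient of the primitive of \<open>u\<close>, whose
  derivative at \<open>t\<close> from the right is \<open>u t\<close>.\<close>

lemma average_approximates:
  fixes u :: "real \<Rightarrow> 'a::banach"
  assumes u: "continuous_on {0..} u" and t: "t \<ge> 0" and e: "e > 0"
  obtains h where "h > 0" "dist (average h u t) (u t) < e"
proof -
  let ?U = "\<lambda>t. integral {0..t} u"
  have "(?U has_derivative (\<lambda>s. s *\<^sub>R u t)) (at t within {0..})"
    using has_vector_derivative_integral_halfline[OF u t] by (simp add: has_vector_derivative_def)
  then obtain d where d: "d > 0" and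
    le: "\<And>s. s \<ge> 0 \<Longrightarrow> norm (s - t) < d \<Longrightarrow>
      norm (?U s - ?U t - (s - t) *\<^sub>R u t) \<le> e / 2 * norm (s - t)"
    unfolding has_derivative_within_alt using half_gt_zero[OF e] by (metis atLeast_iff)
  define h where "h = d / 2"
  have h: "h > 0" "h < d"
    using d by (auto simp: h_def)
  have "average h u t - u t = (?U (t + h) - ?U t - h *\<^sub>R u t) /\<^sub>R h"
    using h by (simp add: average_def algebra_simps)
  then have "dist (average h u t) (u t) = norm (?U (t + h) - ?U t - h *\<^sub>R u t) / h"
    using h by (simp add: dist_norm divide_inverse_commute)
  also have "\<dots> \<le> e / 2"
    using le[of "t + h"] h t by (simp add: pos_divide_le_eq)
  also have "\<dots> < e"
    using e by simp
  finally show ?thesis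
    using that h by blast
qed

text \<open>Integrate the equation over \<open>{0..t}\<close>; the bounded map \<open>G\<close>
  commutes with the integral.\<close>

lemma solution_integral:
  fixes u :: "real \<Rightarrow> 'a::banach" and L G :: "'a \<Rightarrow> 'b::banach"
  assumes G: "bounded_linear G" and u: "solution L G u" and t: "t \<ge> 0"
  shows "G (integral {0..t} u) = L (u t) - L (u 0)"
proof -
  have "((\<lambda>t. G (u t)) has_integral (L (u t) - L (u 0))) {0..t}"
    using u t by (intro fundamental_theorem_of_calculus)
      (auto simp: solution_def intro: has_vector_derivative_within_subset[where S = "{0..}"])
  moreover have "u integrable_on {0..t}"
    using u by (intro integrable_continuous_real)
      (auto simp: solution_def intro: continuous_on_subset[where s = "{0..}"])
  then have "integral {0..t} (G \<circ> u) = G (integral {0..t} u)"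
    using G by (rule integral_linear)
  ultimately show ?thesis
    by (simp add: o_def integral_unique)
qed

text \<open>The increment of \<open>L u\<close> over the window, divided by \<open>h\<close>, arises
  twice: as \<open>G\<close> of the average, by the integrated equation, and as the derivative of
  \<open>L\<close> of the average. The first claim is what raises the Wong index: it exhibits a
  preimage under \<open>L\<close> built from values of \<open>u\<close>.\<close>

lemma average_solution:
  fixes u :: "real \<Rightarrow> 'a::banach" and L G :: "'a \<Rightarrow> 'b::banach"
  assumes L: "bounded_linear L" and G: "bounded_linear G"
    and u: "solution L G u" and h: "h > 0"
  shows "t \<ge> 0 \<Longrightarrow> G (average h u t) = L ((u (t + h) - u t) /\<^sub>R h)"
    and "solution L G (average h u)"
proof -
  interpret L: bounded_linear L by fact
  interpret G: bounded_linear G by fact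
  have cont: "continuous_on {0..} u"
    using u by (simp add: solution_def)
  note d = has_vector_derivative_average[OF cont h]
  show *: "G (average h u t) = L ((u (t + h) - u t) /\<^sub>R h)" if "t \<ge> 0" for t
    using solution_integral[OF G u, of t] solution_integral[OF G u, of "t + h"] that h
    by (simp add: average_def G.diff G.scaleR L.diff L.scaleR)
  have "continuous_on {0..} (average h u)"
    using d by (auto simp: continuous_on_eq_continuous_within
        intro: has_vector_derivative_continuous)
  then show "solution L G (average h u)"
    using L.has_vector_derivative[OF d] by (auto simp: solution_def *)
qed

lemma closure_solutions_in_wong_sequence:
  fixes u :: "real \<Rightarrow> 'a::banach" and L G :: "'a \<Rightarrow> 'b::banach"
  assumes L: "bounded_linear L" and G: "bounded_linear G"
    and V0: "V 0 = UNIV" and VSuc: "\<And>i. V (Suc i) = {p. G p \<in> L ` V i}"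
    and u: "solution L G u" and t: "t \<ge> 0"
  shows "u t \<in> closure (V i)"
proof -
  interpret L: bounded_linear L by fact
  interpret G: bounded_linear G by fact
  \<comment> \<open>Real subspaces are enough: averaging forms differences and divides by the real
    \<open>h\<close>.\<close>
  have V: "subspace (V i)" for i
  proof (induction i)
    case (Suc i)
    then have "subspace (G -` L ` V i)"
      by (intro linear_subspace_vimage linear_subspace_image L.linear_axioms G.linear_axioms)
    then show ?case
      by (simp add: VSuc vimage_def)
  qed (simp add: V0)
  \<comment> \<open>Membership is claimed at all times because the next average at \<open>s\<close>
    uses \<open>v\<close> at both \<open>s\<close> and \<open>s + h\<close>. Closeness is claimed
    only at the fixed \<open>t\<close>; \<open>e\<close> varies in the induction, as each step
    spends half of it on the new average.\<close>
  have "\<exists>v. solution L G v \<and> (\<forall>s\<ge>0. v s \<in> V i) \<and> dist (v t) (u t) < e" if "e > 0" for e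
    using that
  proof (induction i arbitrary: e)
    case 0
    then show ?case
      using u by (intro exI[of _ u]) (simp add: V0)
  next
    case (Suc i)
    obtain v where v: "solution L G v" "\<And>s. s \<ge> 0 \<Longrightarrow> v s \<in> V i" "dist (v t) (u t) < e / 2"
      using Suc.IH[of "e / 2"] Suc.prems by auto
    obtain h where h: "h > 0" "dist (average h v t) (v t) < e / 2"
      using average_approximates[of v t "e / 2"] v(1) t Suc.prems by (auto simp: solution_def)
    have "average h v s \<in> V (Suc i)" if "s \<ge> 0" for s
    proof -
      have "(v (s + h) - v s) /\<^sub>R h \<in> V i"
        using v(2) h that by (intro subspace_scale subspace_diff V) auto
      then show ?thesis
        by (simp add: VSuc average_solution(1)[OF L G v(1) h(1) that])
    qed
    moreover have "dist (average h v t) (u t) < e"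
      using dist_triangle[of "average h v t" "u t" "v t"] h(2) v(3) by linarith
    ultimately show ?case
      using average_solution(2)[OF L G v(1) h(1)] by blast
  qed
  then show ?thesis
    using t by (meson closure_approachable)
qed

theorem theorem2p13:
  fixes E A :: "'x::complex_hilbert \<Rightarrow> 'z::complex_hilbert"
    and D :: "'x set"
    and \<mu> :: complex
    and \<iota> :: "'z \<Rightarrow> 'w::complex_banach"
    and x0 :: 'x
    and x :: "real \<Rightarrow> 'x"
    and f :: "real \<Rightarrow> 'w"
    and t :: real
  assumes "bounded_clinear E"
    and "closed_operator D A"
    and "densely_defined D"
    and "resolvent_set E D A \<noteq> {}"
    and "\<mu> \<in> resolvent_set E D A"
    and "completion_embedding (extrapolation_norm E D A \<mu>) \<iota>"
    and "(x0, f) \<in> consistent_data \<iota> E (bounded_extension \<iota> D A)"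
    and "classical_solution \<iota> (\<lambda>(v, w). E v) (\<lambda>(v, w). bounded_extension \<iota> D A v + w) (\<lambda>_. 0)
      (x0, f 0) (\<lambda>t. (x t, f t))"
    and "t \<ge> 0"
  shows "(x t, f t) \<in> (\<Inter>i. closure (augmented_wong \<iota> E (bounded_extension \<iota> D A) i))"
proof
  fix i
  define B where "B = bounded_extension \<iota> D A"
  define L where "L = (\<lambda>p :: 'x \<times> 'w. \<iota> (E (fst p)))"
  define G where "G = (\<lambda>p :: 'x \<times> 'w. B (fst p) + snd p)"
  have "clinear_on D A"
    using assms(2) by (simp add: closed_operator_def)
  from bounded_extension(1)[OF assms(1) this assms(3,5,6)]
  have B: "bounded_linear B"
    unfolding B_def by (rule bounded_clinear_imp_bounded_linear)
  \<comment> \<open>Since \<open>\<iota>\<close> is isometric for the extrapolation norm, its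
    boundedness in the original norm of \<open>'z\<close> is that of the pencil inverse.\<close>
  have "bounded_clinear (pencil_inverse E D A \<mu>)"
    using assms(5) by (simp add: resolvent_set_def)
  then have "bounded_clinear \<iota>"
    using assms(6)
    by (auto simp: bounded_clinear_def completion_embedding_def extrapolation_norm_def)
  then have "bounded_linear \<iota>"
    by (rule bounded_clinear_imp_bounded_linear)
  then have "bounded_linear L"
    unfolding L_def
    by (rule bounded_linear_compose[OF _ bounded_linear_compose[OF
          bounded_clinear_imp_bounded_linear[OF assms(1)] bounded_linear_fst]])
  moreover have "bounded_linear G"
    unfolding G_def
    by (rule bounded_linear_add[OF bounded_linear_compose[OF B bounded_linear_fst]
          bounded_linear_snd])
  moreover have "augmented_wong \<iota> E B (Suc j) = {p. G p \<in> L ` augmented_wong \<iota> E B j}" for j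
    by (force simp: L_def G_def)
  moreover have "solution L G (\<lambda>t. (x t, f t))"
    using assms(8) by (simp add: solution_def classical_solution_def L_def G_def B_def)
  ultimately show "(x t, f t) \<in> closure (augmented_wong \<iota> E (bounded_extension \<iota> D A) i)"
    unfolding B_def[symmetric] using assms(9)
    by (intro closure_solutions_in_wong_sequence[of L G]) auto
qed

end
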